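(* Let $G=SE_2(3)$, with $\mathfrak{se}_2(3)\cong\mathbb{R}^9$. Let $\xi_t\in\mathbb{R}^9$ be the transformed error (defined in the context), with coordinates $(\omega_t,v_{t,1},v_{t,2})$, $\omega_t,v_{t,1},v_{t,2}\in\mathbb{R}^3$, let $\theta_t=\|\omega_t\|$, let $\gamma_{t,k}\in\mathbb{R}^9$ be the diffusion coefficients of $\xi_t$ (defined in the context), and let $$C_{t,k}=\sum_{i=1}^\infty\frac{(-1)^i}{(i+1)!}\sum_{r=0}^{i-1}\mathrm{adm}_{\xi_t}^{r}\,\mathrm{adm}_{\gamma_{t,k}}\,\mathrm{adm}_{\xi_t}^{i-1-r}\gamma_{t,k}.$$ Then the right Jacobian is $$\mathrm{dexp_m}(-\xi_t)=I+\sum_{j=1}^4\beta_{t,j}\,\mathrm{adm}_{\xi_t}^j,$$ with $$\beta_{t,1}=\frac{4\cos\theta_t-4+\theta_t\sin\theta_t}{2\theta_t^2},\quad \beta_{t,2}=\frac{4\theta_t-5\sin\theta_t+\theta_t\cos\theta_t}{2\theta_t^3},$$ $$\beta_{t,3}=\frac{\theta_t\sin\theta_t+2\cos\theta_t-2}{2\theta_t^4},\quad \beta_{t,4}=\frac{2\theta_t-3\sin\theta_t+\theta_t\cos\theta_t}{2\theta_t^5},$$ and $$C_{t,k}=\sum_{j=1}^4\Big(\beta'_{t,j}\,\theta'_t\,\mathrm{adm}_{\xi_t}^j\gamma_{t,k}+\beta_{t,j}\sum_{r=0}^{j-1}\mathrm{adm}_{\xi_t}^{r}\,\mathrm{adm}_{\gamma_{t,k}}\,\mathrm{adm}_{\xi_t}^{j-1-r}\gamma_{t,k}\Big),\qquad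 \theta'_t=\begin{bmatrix}\omega_t^\top&0&0\end{bmatrix}\gamma_{t,k},$$ with $$\beta'_{t,1}=\frac{16-16\cos\theta_t+2\theta_t\cos\theta_t-5\theta_t\sin\theta_t}{4\theta_t},\quad \beta'_{t,2}=\frac{15\sin\theta_t-8\theta_t-7\theta_t\cos\theta_t-\theta_t^2\sin\theta_t}{2\theta_t^4},$$ $$\beta'_{t,3}=\frac{8-5\theta_t\sin\theta_t+\theta_t^2\cos\theta_t-8\cos\theta_t}{2\theta_t^5},\quad \beta'_{t,4}=\frac{15\sin\theta_t-\theta_t^2\sin\theta_t-7\theta_t\cos\theta_t-8\theta_t}{2\theta_t^6}.$$
   Context: $SE_2(3)$ is the group of $5\times5$ matrices $\begin{bmatrix}R&t_1\ t_2\\0&I_2\end{bmatrix}$ with $R\in SO(3)$ and $t_1,t_2\in\mathbb{R}^3$. Its Lie algebra $\mathfrak{se}_2(3)$ consists of the matrices $\xi^\wedge=\begin{bmatrix}\omega^\wedge&v_1\ v_2\\0&0\end{bmatrix}$, where $\xi=(\omega,v_1,v_2)\in\mathbb{R}^9$ and $\omega^\wedge$ is the $3\times 3$ skew-symmetric matrix with $\omega^\wedge a=\omega\times a$. The inverse of $(\cdot)^\wedge$ is $(\cdot)^\vee$. For $x\in\mathbb{R}^9$, $\mathrm{adm}_x$ is the $9\times9$ matrix with $\mathrm{adm}_xy=[x^\wedge,y^\wedge]^\vee$, and $\mathrm{dexp_m}(x)=\sum_{i=0}^\infty\frac{1}{(i+1)!}\mathrm{adm}_x^i$, with matrix inverse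 $\mathrm{dexp}_{\rm m}^{-1}(x)$ when it exists. $\log_{\rm m}$ is the inverse of $x\mapsto\exp(x^\wedge)$, defined near the identity. Setting: $X_t\in SE_2(3)$ is the noisy state driven by $X_t\sum_{k=1}^9s_k^\wedge\,\mathrm dW_{t,k}$ (with $s_k\in\mathbb{R}^9$ and $W_t$ a 9-dimensional Brownian motion), $\hat X_t\in SE_2(3)$ is the noise-free estimate, and the transformed error is $\xi_t=\log_{\rm m}(\hat X_t^{-1}X_t)$ (left-invariant) or $\xi_t=\log_{\rm m}(X_t\hat X_t^{-1})$ (right-invariant), with $\mathrm{dexp_m}(-\xi_t)$ invertible. The error obeys an Itô SDE $\mathrm d\xi_t=\big(A_t\xi_t-\frac12\sum_{k}\mathrm{dexp}_{\rm m}^{-1}(-\xi_t)C_{t,k}\big)\mathrm dt+\sum_k\gamma_{t,k}\,\mathrm dW_{t,k}$ with $A_t$ a linear map on $\mathbb{R}^9$, and the diffusion coefficients are $\gamma_{t,k}=\mathrm{dexp}_{\rm m}^{-1}(-\xi_t)s_k$ in the left-invariant case and $\gamma_{t,k}=\mathrm{dexp}_{\rm m}^{-1}(-\xi_t)(\hat X_ts_k^\wedge\hat X_t^{-1})^\vee$ in the right-invariant case.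
   Formalization: As printed the formula for C fails: β'_{t,1} is corrected to dβ_1/dθ = (8−5θ sin θ+θ² cos θ−8 cos θ)/(2θ³) and θ'_t to [ω^T 0 0]γ/θ_t; at θ_t=0 the coefficients are read as their limits. *)

theory Defs
  imports "HOL-Analysis.Analysis"
begin

section \<open>Matrix powers and the matrix exponential\<close>

text \<open>The type class operations \<open>*\<close> and \<open>^\<close> on \<^typ>\<open>real^'n^'n\<close> are componentwise, so powers
  with respect to the matrix product and the exponential series are introduced separately.\<close>

definition mpow :: "real^'n^'n \<Rightarrow> nat \<Rightarrow> real^'n^'n" where
  "mpow A i = (((**) A) ^^ i) (mat 1)"

definition mexp :: "real^'n^'n \<Rightarrow> real^'n^'n" where
  "mexp A = (\<Sum>i. (1 / fact i) *\<^sub>R mpow A i)"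


section \<open>The group \<open>SE\<^sub>2(3)\<close> and its Lie algebra\<close>

definition block5 :: "real^3^3 \<Rightarrow> real^3 \<Rightarrow> real^3 \<Rightarrow> real^2^2 \<Rightarrow> real^5^5" where
  "block5 R t1 t2 D = vector
    [vector [R$1$1, R$1$2, R$1$3, t1$1, t2$1],
     vector [R$2$1, R$2$2, R$2$3, t1$2, t2$2],
     vector [R$3$1, R$3$2, R$3$3, t1$3, t2$3],
     vector [0, 0, 0, D$1$1, D$1$2],
     vector [0, 0, 0, D$2$1, D$2$2]]"

definition SE23 :: "(real^5^5) set" where
  "SE23 = {block5 R t1 t2 (mat 1) | R t1 t2. rotation_matrix R}"

text \<open>A vector of \<open>\<real>\<^sup>9\<close> is read as \<open>(\<omega>, v\<^sub>1, v\<^sub>2)\<close>.\<close>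

definition rot_part :: "real^9 \<Rightarrow> real^3" where
  "rot_part x = vector [x$1, x$2, x$3]"

definition trans1_part :: "real^9 \<Rightarrow> real^3" where
  "trans1_part x = vector [x$4, x$5, x$6]"

definition trans2_part :: "real^9 \<Rightarrow> real^3" where
  "trans2_part x = vector [x$7, x$8, x$9]"

definition skew3 :: "real^3 \<Rightarrow> real^3^3" where
  "skew3 \<omega> = matrix (\<lambda>a. cross3 \<omega> a)"

definition hat :: "real^9 \<Rightarrow> real^5^5" where
  "hat x = block5 (skew3 (rot_part x)) (trans1_part x) (trans2_part x) 0"

definition vee :: "real^5^5 \<Rightarrow> real^9" where
  "vee = inv hat"

definition adm :: "real^9 \<Rightarrow> real^9^9" where
  "adm x = matrix (\<lambda>y. vee (hat x ** hat y - hat y ** hat x))"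

definition dexpm :: "real^9 \<Rightarrow> real^9^9" where
  "dexpm x = (\<Sum>i. (1 / fact (i + 1)) *\<^sub>R mpow (adm x) i)"

text \<open>The logarithm is a local inverse of \<open>x \<mapsto> exp(x\<^sup>\<and>)\<close> near the identity. The domain is left as
  a parameter: \<open>U\<close> is any open neighbourhood of \<open>0\<close> on which that map is injective, and the
  logarithm is meant on the image of \<open>U\<close>.\<close>

definition log_chart :: "(real^9) set \<Rightarrow> bool" where
  "log_chart U \<longleftrightarrow> open U \<and> 0 \<in> U \<and> inj_on (\<lambda>x. mexp (hat x)) U"

definition logm :: "(real^9) set \<Rightarrow> real^5^5 \<Rightarrow> real^9" where
  "logm U = the_inv_into U (\<lambda>x. mexp (hat x))"


section \<open>The transformed error and its diffusion coefficients\<close>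

datatype invariance = Left_Invariant | Right_Invariant

text \<open>\<open>Xh\<close> is the noise-free estimate and \<open>X\<close> the noisy state, at a fixed time and outcome.\<close>

fun group_error :: "invariance \<Rightarrow> real^5^5 \<Rightarrow> real^5^5 \<Rightarrow> real^5^5" where
  "group_error Left_Invariant Xh X = matrix_inv Xh ** X"
| "group_error Right_Invariant Xh X = X ** matrix_inv Xh"

fun diffusion_coeff :: "invariance \<Rightarrow> real^5^5 \<Rightarrow> real^9 \<Rightarrow> real^9 \<Rightarrow> real^9" where
  "diffusion_coeff Left_Invariant Xh \<xi> s = matrix_inv (dexpm (- \<xi>)) *v s"
| "diffusion_coeff Right_Invariant Xh \<xi> s =
     matrix_inv (dexpm (- \<xi>)) *v vee (Xh ** hat s ** matrix_inv Xh)"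

definition adm_sum :: "real^9 \<Rightarrow> real^9 \<Rightarrow> nat \<Rightarrow> real^9" where
  "adm_sum \<xi> \<gamma> i =
     (\<Sum>r<i. mpow (adm \<xi>) r *v (adm \<gamma> *v (mpow (adm \<xi>) (i - 1 - r) *v \<gamma>)))"

text \<open>The term for \<open>i = 0\<close> is zero (empty inner sum), so this is the series over \<open>i \<ge> 1\<close>.\<close>

definition ito_correction :: "real^9 \<Rightarrow> real^9 \<Rightarrow> real^9" where
  "ito_correction \<xi> \<gamma> = (\<Sum>i. ((- 1) ^ i / fact (i + 1)) *\<^sub>R adm_sum \<xi> \<gamma> i)"


section \<open>The coefficient functions\<close>

text \<open>The quotients below have removable singularities at \<open>\<theta> = 0\<close>; there they denote their limits.\<close>

definition at_zero_by_limit :: "(real \<Rightarrow> real) \<Rightarrow> real \<Rightarrow> real" where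
  "at_zero_by_limit f \<theta> = (if \<theta> = 0 then Lim (at 0) f else f \<theta>)"

definition beta1 :: "real \<Rightarrow> real" where
  "beta1 = at_zero_by_limit (\<lambda>\<theta>. (4 * cos \<theta> - 4 + \<theta> * sin \<theta>) / (2 * \<theta> ^ 2))"

definition beta2 :: "real \<Rightarrow> real" where
  "beta2 = at_zero_by_limit (\<lambda>\<theta>. (4 * \<theta> - 5 * sin \<theta> + \<theta> * cos \<theta>) / (2 * \<theta> ^ 3))"

definition beta3 :: "real \<Rightarrow> real" where
  "beta3 = at_zero_by_limit (\<lambda>\<theta>. (\<theta> * sin \<theta> + 2 * cos \<theta> - 2) / (2 * \<theta> ^ 4))"

definition beta4 :: "real \<Rightarrow> real" where
  "beta4 = at_zero_by_limit (\<lambda>\<theta>. (2 * \<theta> - 3 * sin \<theta> + \<theta> * cos \<theta>) / (2 * \<theta> ^ 5))"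

text \<open>The functions \<open>dbeta\<^sub>j\<close> are the derivatives of \<open>beta\<^sub>j\<close> with respect to \<open>\<theta>\<close>. The source prints
  \<open>(16 - 16 cos \<theta> + 2 \<theta> cos \<theta> - 5 \<theta> sin \<theta>) / (4 \<theta>)\<close> for the first one, which is not the derivative
  of \<open>beta\<^sub>1\<close> and makes the formula for the correction term false; the derivative is used here.\<close>

definition dbeta1 :: "real \<Rightarrow> real" where
  "dbeta1 = at_zero_by_limit
     (\<lambda>\<theta>. (8 - 5 * \<theta> * sin \<theta> + \<theta> ^ 2 * cos \<theta> - 8 * cos \<theta>) / (2 * \<theta> ^ 3))"

definition dbeta2 :: "real \<Rightarrow> real" where
  "dbeta2 = at_zero_by_limit
     (\<lambda>\<theta>. (15 * sin \<theta> - 8 * \<theta> - 7 * \<theta> * cos \<theta> - \<theta> ^ 2 * sin \<theta>) / (2 * \<theta> ^ 4))"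

definition dbeta3 :: "real \<Rightarrow> real" where
  "dbeta3 = at_zero_by_limit
     (\<lambda>\<theta>. (8 - 5 * \<theta> * sin \<theta> + \<theta> ^ 2 * cos \<theta> - 8 * cos \<theta>) / (2 * \<theta> ^ 5))"

definition dbeta4 :: "real \<Rightarrow> real" where
  "dbeta4 = at_zero_by_limit
     (\<lambda>\<theta>. (15 * sin \<theta> - \<theta> ^ 2 * sin \<theta> - 7 * \<theta> * cos \<theta> - 8 * \<theta>) / (2 * \<theta> ^ 6))"

definition beta :: "nat \<Rightarrow> real \<Rightarrow> real" where
  "beta j \<theta> = [beta1 \<theta>, beta2 \<theta>, beta3 \<theta>, beta4 \<theta>] ! (j - 1)"

definition dbeta :: "nat \<Rightarrow> real \<Rightarrow> real" where
  "dbeta j \<theta> = [dbeta1 \<theta>, dbeta2 \<theta>, dbeta3 \<theta>, dbeta4 \<theta>] ! (j - 1)"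

text \<open>The derivative of \<open>\<theta> = \<parallel>\<omega>\<parallel>\<close> in the direction \<open>\<gamma>\<close>. The source omits the factor \<open>1 / \<theta>\<close>, without
  which the formula for the correction term fails in general. For \<open>\<theta> = 0\<close> the value is immaterial,
  since every \<open>dbeta\<^sub>j\<close> vanishes there.\<close>

definition theta_rate :: "real^9 \<Rightarrow> real^9 \<Rightarrow> real" where
  "theta_rate \<xi> \<gamma> = (rot_part \<xi> \<bullet> rot_part \<gamma>) / norm (rot_part \<xi>)"

end

theory Submission
  imports Defs
begin

text \<open>For \<open>A = adm\<^sub>\<xi>\<close> and \<open>z = - \<theta>\<^sup>2\<close>, the block triangular shape of \<open>A\<close> gives \<open>A (A\<^sup>2 - z)\<^sup>2 = 0\<close>.
  Hence every power \<open>A\<^sup>n\<close> with \<open>n > 0\<close> is a combination of \<open>A, \<dots>, A\<^sup>4\<close> whose coefficients are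
  monomials in \<open>z\<close>, and summing \<open>(- A)\<^sup>n / (n + 1)!\<close> gives the Jacobian with coefficients built from
  \<open>E(z) = \<Sum> z\<^sup>m / (2 m + 2)!\<close>, \<open>S(z) = \<Sum> z\<^sup>m / (2 m + 3)!\<close> and their derivatives.  At \<open>z = - \<theta>\<^sup>2\<close>
  these are \<open>(1 - cos \<theta>) / \<theta>\<^sup>2\<close> and \<open>(\<theta> - sin \<theta>) / \<theta>\<^sup>3\<close>.  The inner sum of the correction term is the
  derivative of \<open>A\<^sup>i \<gamma>\<close> along \<open>\<xi> + t \<gamma>\<close> with the trailing factor \<open>\<gamma>\<close> held fixed. The same relation
  holds along this line, so differentiating the reduction of each single power, where only
  polynomials in \<open>z\<close> occur, and summing afterwards gives the second formula, without a termwise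
  differentiation of the matrix series.\<close>

subsection \<open>The adjoint representation in coordinates\<close>

lemma exhaust_5:
  fixes x :: 5
  shows "x = 1 \<or> x = 2 \<or> x = 3 \<or> x = 4 \<or> x = 5"
proof (induct x)
  case (of_int z)
  then have "z = 0 \<or> z = 1 \<or> z = 2 \<or> z = 3 \<or> z = 4" by fastforce
  then show ?case by auto
qed
lemma exhaust_9:
  fixes x :: 9
  shows "x = 1 \<or> x = 2 \<or> x = 3 \<or> x = 4 \<or> x = 5 \<or> x = 6 \<or> x = 7 \<or> x = 8 \<or> x = 9"
proof (induct x)
  case (of_int z)
  then have "z = 0 \<or> z = 1 \<or> z = 2 \<or> z = 3 \<or> z = 4 \<or> z = 5 \<or> z = 6 \<or> z = 7 \<or> z = 8" by fastforce
  then show ?case by auto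
qed
lemma forall_5: "(\<forall>i::5. P i) \<longleftrightarrow> P 1 \<and> P 2 \<and> P 3 \<and> P 4 \<and> P 5"
  by (metis exhaust_5)
lemma forall_9: "(\<forall>i::9. P i) \<longleftrightarrow> P 1 \<and> P 2 \<and> P 3 \<and> P 4 \<and> P 5 \<and> P 6 \<and> P 7 \<and> P 8 \<and> P 9"
  by (metis exhaust_9)
lemma UNIV_5: "UNIV = {1, 2, 3, 4, 5::5}"
  using exhaust_5 by auto
lemma sum_5: "sum f (UNIV::5 set) = f 1 + f 2 + f 3 + f 4 + f 5"
  unfolding UNIV_5 by (simp add: ac_simps)

lemma vector_5 [simp]:
  "(vector [a,b,c,d,e] :: 'a::zero^5) $ 1 = a"
  "(vector [a,b,c,d,e] :: 'a^5) $ 2 = b"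
  "(vector [a,b,c,d,e] :: 'a^5) $ 3 = c"
  "(vector [a,b,c,d,e] :: 'a^5) $ 4 = d"
  "(vector [a,b,c,d,e] :: 'a^5) $ 5 = e"
  by (simp_all add: vector_def)

lemma vector_9 [simp]:
  "(vector [a,b,c,d,e,f,g,h,i] :: 'a::zero^9) $ 1 = a"
  "(vector [a,b,c,d,e,f,g,h,i] :: 'a^9) $ 2 = b"
  "(vector [a,b,c,d,e,f,g,h,i] :: 'a^9) $ 3 = c"
  "(vector [a,b,c,d,e,f,g,h,i] :: 'a^9) $ 4 = d"
  "(vector [a,b,c,d,e,f,g,h,i] :: 'a^9) $ 5 = e"
  "(vector [a,b,c,d,e,f,g,h,i] :: 'a^9) $ 6 = f"
  "(vector [a,b,c,d,e,f,g,h,i] :: 'a^9) $ 7 = g"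
  "(vector [a,b,c,d,e,f,g,h,i] :: 'a^9) $ 8 = h"
  "(vector [a,b,c,d,e,f,g,h,i] :: 'a^9) $ 9 = i"
  by (simp_all add: vector_def)

lemma skew3_nth: "skew3 w = vector [vector [0, - w$3, w$2], vector [w$3, 0, - w$1], vector [- w$2, w$1, 0]]"
  by (simp add: skew3_def matrix_def vec_eq_iff forall_3 cross3_def axis_def)

text \<open>Since \<open>vee\<close> is \<open>inv hat\<close> and \<open>hat\<close> is not onto,
  injectivity is what gives \<open>vee (hat x) = x\<close>.\<close>

lemma inj_hat: "inj hat"
  by (rule injI) (simp add: hat_def block5_def skew3_nth rot_part_def trans1_part_def trans2_part_def vec_eq_iff forall_5 forall_9)

text \<open>The Lie bracket carried over to coordinates; cross products make the Lagrange identity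
  available.\<close>

definition bracket9 :: "real^9 \<Rightarrow> real^9 \<Rightarrow> real^9" where
  "bracket9 x y =
     (let a = cross3 (rot_part x) (rot_part y);
          b = cross3 (rot_part x) (trans1_part y) + cross3 (trans1_part x) (rot_part y);
          c = cross3 (rot_part x) (trans2_part y) + cross3 (trans2_part x) (rot_part y)
      in vector [a$1, a$2, a$3, b$1, b$2, b$3, c$1, c$2, c$3])"

lemma hat_bracket9: "hat x ** hat y - hat y ** hat x = hat (bracket9 x y)"
  by (simp add: hat_def block5_def skew3_nth rot_part_def trans1_part_def trans2_part_def
    vec_eq_iff forall_5 matrix_matrix_mult_def sum_5 bracket9_def cross3_def)

unbundle cross3_syntax

lemma parts_eqI:
  assumes "rot_part x = rot_part y" "trans1_part x = trans1_part y" "trans2_part x = trans2_part y"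
  shows "x = y"
  using assms
  by (simp add: rot_part_def trans1_part_def trans2_part_def vec_eq_iff forall_3 forall_9)

lemma parts_bracket9 [simp]:
  "rot_part (bracket9 x y) = cross3 (rot_part x) (rot_part y)"
  "trans1_part (bracket9 x y) = cross3 (rot_part x) (trans1_part y) + cross3 (trans1_part x) (rot_part y)"
  "trans2_part (bracket9 x y) = cross3 (rot_part x) (trans2_part y) + cross3 (trans2_part x) (rot_part y)"
  by (simp_all add: bracket9_def rot_part_def trans1_part_def trans2_part_def vec_eq_iff forall_3 Let_def)

lemma parts_linear [simp]:
  "rot_part (x + y) = rot_part x + rot_part y" "rot_part (c *\<^sub>R x) = c *\<^sub>R rot_part x"
  "trans1_part (x + y) = trans1_part x + trans1_part y" "trans1_part (c *\<^sub>R x) = c *\<^sub>R trans1_part x"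
  "trans2_part (x + y) = trans2_part x + trans2_part y" "trans2_part (c *\<^sub>R x) = c *\<^sub>R trans2_part x"
  "rot_part (x - y) = rot_part x - rot_part y" "trans1_part (x - y) = trans1_part x - trans1_part y"
  "trans2_part (x - y) = trans2_part x - trans2_part y"
  by (simp_all add: rot_part_def trans1_part_def trans2_part_def vec_eq_iff forall_3)

lemma linear_bracket9: "linear (bracket9 x)"
  by (rule linearI; rule parts_eqI)
     (simp_all add: cross_add_right cross_mult_right scaleR_right_distrib algebra_simps)

lemma adm_mult_vec: "adm x *v y = bracket9 x y"
proof -
  have "adm x = matrix (bracket9 x)"
    by (simp add: adm_def vee_def hat_bracket9 inv_f_f[OF inj_hat])
  then show ?thesis
    by (simp add: fun_cong[OF matrix_vector_mul(2)[OF linear_bracket9]])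
qed

text \<open>Lines in \<xi> thus become lines of matrices, along which powers are
  differentiated.\<close>

lemma adm_add_scaleR: "adm (x + t *\<^sub>R y) = adm x + t *\<^sub>R adm y"
  unfolding matrix_eq
  by (auto simp: adm_mult_vec matrix_vector_mult_add_rdistrib scaleR_matrix_vector_assoc[symmetric]
     cross_add_left cross_mult_left scaleR_right_distrib intro!: parts_eqI)

lemma adm_uminus: "adm (- x) = - adm x"
  \<comment> \<open>The second instance reads \<open>adm 0 = adm 0 - adm 0\<close>, hence
    \<open>adm 0 = 0\<close>.\<close>
  using adm_add_scaleR[of 0 "-1" x] adm_add_scaleR[of 0 "-1" 0] by simp

text \<open>By Lagrange the inner double product is (w . a) w - (w . w) a, and the outer factor
  kills the first term.\<close>

lemma cross_cube:
  "cross3 w (cross3 w (cross3 w a)) = - ((w \<bullet> w) *\<^sub>R cross3 w a)"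
  by (simp add: Lagrange Cross3.right_diff_distrib cross_mult_right)

text \<open>Diagonal blocks killed by W^3 + u W alone would give a relation of degree six; the cross
  product computation shows that degree five suffices.\<close>

lemma adm_power5_vec:
  fixes x y :: "real^9"
  defines "B \<equiv> bracket9 x" and "u \<equiv> rot_part x \<bullet> rot_part x"
  shows "B (B (B (B (B y)))) = - (2 * u) *\<^sub>R B (B (B y)) + (- (u\<^sup>2)) *\<^sub>R B y"
proof -
  have times_2: "z * 2 = 2 *\<^sub>R z" "2 * z = 2 *\<^sub>R z" for z :: "real^3"
    by (simp_all add: vec_eq_iff)
  \<comment> \<open>The translational component: \<open>w\<close>, \<open>v\<close> are parts of
    \<open>x\<close>, and \<open>a\<close>, \<open>b\<close> parts of \<open>y\<close>.\<close>
  have *: "w \<times> (w \<times> (w \<times> (w \<times> (w \<times> b + v \<times> a) + v \<times> (w \<times> a)) + v \<times> (w \<times> (w \<times> a))) + v \<times> (w \<times> (w \<times> (w \<times> a)))) +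
    v \<times> (w \<times> (w \<times> (w \<times> (w \<times> a))))
    = - (2 * (w \<bullet> w)) *\<^sub>R (w \<times> (w \<times> (w \<times> b + v \<times> a) + v \<times> (w \<times> a)) + v \<times> (w \<times> (w \<times> a)))
    + (- (w \<bullet> w)\<^sup>2) *\<^sub>R (w \<times> b + v \<times> a)" for w v a b :: "real^3"
    unfolding Lagrange
    by (simp add: Lagrange cross_add_right cross_mult_right dot_cross_self algebra_simps inner_add_right power2_eq_square Cross3.right_diff_distrib)
      (simp add: cross_skew[of v w] inner_commute[of v w] times_2 cross_mult_right mult.commute mult.left_commute)
  have r: "w \<times> (w \<times> (w \<times> (w \<times> (w \<times> a)))) = - (2 * (w \<bullet> w)) *\<^sub>R (w \<times> (w \<times> (w \<times> a))) + (- (w \<bullet> w)\<^sup>2) *\<^sub>R (w \<times> a)"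
    for w a :: "real^3"
    by (simp add: cross_cube cross_mult_right cross_minus_right power2_eq_square times_2)
  show ?thesis
    unfolding assms by (rule parts_eqI) (simp_all only: parts_bracket9 parts_linear r *)
qed

subsection \<open>Matrix powers and their directional derivatives\<close>

lemma mpow_0 [simp]: "mpow A 0 = mat 1"
  by (simp add: mpow_def)

lemma mpow_Suc: "mpow A (Suc n) = A ** mpow A n"
  by (simp add: mpow_def)

lemma mpow_add: "mpow A (m + n) = mpow A m ** mpow A n"
  by (induction m) (simp_all add: mpow_Suc matrix_mul_assoc)

lemma mpow_scaleR: "mpow (c *\<^sub>R A) n = c ^ n *\<^sub>R mpow A n"
  by (induction n) (simp_all add: mpow_Suc scalar_matrix_assoc[symmetric] matrix_scalar_ac)

text \<open>The product rule for (A + t H)^n y at t = 0, with \<open>y\<close> fixed: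
  \<open>H\<close> replaces each factor in turn. This is \<open>adm_sum\<close> for general
  matrices.\<close>

definition mpow_deriv :: "real^'n^'n \<Rightarrow> real^'n^'n \<Rightarrow> real^'n \<Rightarrow> nat \<Rightarrow> real^'n" where
  "mpow_deriv A H y n = (\<Sum>r<n. mpow A r *v (H *v (mpow A (n - 1 - r) *v y)))"

lemma mpow_deriv_Suc:
  "mpow_deriv A H y (Suc n) = A *v mpow_deriv A H y n + H *v (mpow A n *v y)"
  unfolding mpow_deriv_def
  by (subst sum.lessThan_Suc_shift)
     (simp add: mpow_Suc linear_sum[OF matrix_vector_mul_linear] matrix_vector_mul_assoc[symmetric])

lemma has_vector_derivative_mpow:
  "((\<lambda>t. mpow (A + t *\<^sub>R H) n *v y) has_vector_derivative mpow_deriv A H y n) (at 0)"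
proof (induction n)
  case 0
  show ?case by (simp add: mpow_deriv_def)
next
  case (Suc n)
  let ?g = "\<lambda>t. mpow (A + t *\<^sub>R H) n *v y"
  \<comment> \<open>At \<open>t = 0\<close> the product rule for the second summand leaves only
    \<open>H *v ?g 0\<close>.\<close>
  have "((\<lambda>t. A *v ?g t + t *\<^sub>R (H *v ?g t)) has_vector_derivative
     A *v mpow_deriv A H y n + (0 *\<^sub>R (H *v mpow_deriv A H y n) + 1 *\<^sub>R (H *v ?g 0))) (at 0)"
    by (intro has_vector_derivative_add has_vector_derivative_scaleR
        bounded_linear.has_vector_derivative[OF matrix_vector_mul_bounded_linear] Suc DERIV_ident)
  also have "(\<lambda>t. A *v ?g t + t *\<^sub>R (H *v ?g t)) = (\<lambda>t. mpow (A + t *\<^sub>R H) (Suc n) *v y)"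
    by (simp add: fun_eq_iff mpow_Suc matrix_vector_mul_assoc[symmetric] matrix_vector_mult_add_rdistrib
       scaleR_matrix_vector_assoc[symmetric])
  finally show ?case by (simp add: mpow_deriv_Suc)
qed

text \<open>For a matrix annihilated by \<open>x (x\<^sup>2 - z)\<^sup>2\<close>, a power \<open>x\<^bsup>2m+k+1\<^esup>\<close> is reduced with
  \<open>x\<^bsup>2m\<^esup> \<equiv> z\<^sup>m + m z\<^bsup>m-1\<^esup> (x\<^sup>2 - z)\<close> modulo \<open>(x\<^sup>2 - z)\<^sup>2\<close>.\<close>

lemma mpow_reduce:
  fixes A :: "real^'n^'n"
  assumes A5: "mpow A 5 = (2 * z) *\<^sub>R mpow A 3 + (- (z\<^sup>2)) *\<^sub>R mpow A 1"
  shows "mpow A (2 * m + Suc k) = ((1 - real m) * z ^ m) *\<^sub>R mpow A (Suc k)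
           + (real m * z ^ (m - 1)) *\<^sub>R mpow A (k + 3)"
proof (induction m)
  case 0
  show ?case by simp
next
  case (Suc m)
  have A5': "mpow A (k + 5) = (2 * z) *\<^sub>R mpow A (k + 3) + (- (z\<^sup>2)) *\<^sub>R mpow A (k + 1)"
    unfolding mpow_add A5 matrix_add_ldistrib by (simp only: scalar_matrix_assoc[symmetric] matrix_scalar_ac)
  have "mpow A (2 * Suc m + Suc k) = mpow A 2 ** mpow A (2 * m + Suc k)"
    by (simp add: mpow_add[symmetric] add.assoc)
  also have "\<dots> = ((1 - real m) * z ^ m) *\<^sub>R mpow A (k + 3) + (real m * z ^ (m - 1)) *\<^sub>R mpow A (k + 5)"
    unfolding Suc using mpow_add[of A 2 "Suc k"] mpow_add[of A 2 "k + 3"]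
    by (simp add: matrix_add_ldistrib scalar_matrix_assoc[symmetric] matrix_scalar_ac numeral_eq_Suc)
  also have "\<dots> = ((1 - real m) * z ^ m + 2 * z * (real m * z ^ (m - 1))) *\<^sub>R mpow A (k + 3)
      - (z\<^sup>2 * (real m * z ^ (m - 1))) *\<^sub>R mpow A (Suc k)"
    unfolding A5' by (simp add: algebra_simps)
  \<comment> \<open>At \<open>m = 0\<close> the truncated exponent \<open>m - 1\<close> is harmless,
    its factor \<open>real m\<close> being zero.\<close>
  also have "(1 - real m) * z ^ m + 2 * z * (real m * z ^ (m - 1)) = real (Suc m) * z ^ m"
    by (cases m) (simp_all add: algebra_simps)
  also have "z\<^sup>2 * (real m * z ^ (m - 1)) = - ((1 - real (Suc m)) * z ^ Suc m)"
    by (cases m) (simp_all add: algebra_simps power2_eq_square)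
  finally show ?case by (simp add: add.commute)
qed

text \<open>Both sides of the reduction are differentiated along the line, where z varies with t;
  derivatives are unique.\<close>

lemma mpow_deriv_reduce:
  assumes A5: "\<And>t. mpow (A + t *\<^sub>R H) 5
      = (2 * z t) *\<^sub>R mpow (A + t *\<^sub>R H) 3 + (- ((z t)\<^sup>2)) *\<^sub>R mpow (A + t *\<^sub>R H) 1"
    and z: "(z has_real_derivative z') (at 0)"
  shows "mpow_deriv A H y (2 * m + Suc k) =
      (real m * (1 - real m) * z 0 ^ (m - 1) * z') *\<^sub>R (mpow A (Suc k) *v y)
    + ((1 - real m) * z 0 ^ m) *\<^sub>R mpow_deriv A H y (Suc k)
    + (real m * (real m - 1) * z 0 ^ (m - 2) * z') *\<^sub>R (mpow A (k + 3) *v y)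
    + (real m * z 0 ^ (m - 1)) *\<^sub>R mpow_deriv A H y (k + 3)" (is "_ = ?D")
proof -
  have a: "((\<lambda>t. (1 - real m) * z t ^ m) has_real_derivative
      real m * (1 - real m) * z 0 ^ (m - 1) * z') (at 0)"
    by (auto intro!: derivative_eq_intros z)
  have b: "((\<lambda>t. real m * z t ^ (m - 1)) has_real_derivative
      real m * (real m - 1) * z 0 ^ (m - 2) * z') (at 0)"
    by (cases m) (auto intro!: derivative_eq_intros z simp: numeral_2_eq_2)
  have "((\<lambda>t. ((1 - real m) * z t ^ m) *\<^sub>R (mpow (A + t *\<^sub>R H) (Suc k) *v y)
      + (real m * z t ^ (m - 1)) *\<^sub>R (mpow (A + t *\<^sub>R H) (k + 3) *v y))
     has_vector_derivative ?D) (at 0)"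
    using has_vector_derivative_add[OF
        has_vector_derivative_scaleR[OF a has_vector_derivative_mpow[of A H "Suc k" y]]
        has_vector_derivative_scaleR[OF b has_vector_derivative_mpow[of A H "k + 3" y]]]
    by (simp add: add_ac)
  then have "((\<lambda>t. mpow (A + t *\<^sub>R H) (2 * m + Suc k) *v y) has_vector_derivative ?D) (at 0)"
    by (simp only: mpow_reduce[OF A5] matrix_vector_mult_add_rdistrib scaleR_matrix_vector_assoc)
  then show ?thesis
    using vector_derivative_unique_at has_vector_derivative_mpow by blast
qed

text \<open>Each subseries is padded with zeros, and the two padded series are added.\<close>

lemma sums_even_odd:
  fixes f :: "nat \<Rightarrow> 'a::real_normed_vector"
  assumes "(\<lambda>m. f (2 * m)) sums a" "(\<lambda>m. f (2 * m + 1)) sums b"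
  shows "f sums (a + b)"
proof -
  have "(\<lambda>n. if even n then f n else 0) sums a"
    by (rule sums_mono_reindex[THEN iffD1, of "\<lambda>m. 2 * m"])
       (use assms(1) in \<open>auto simp: strict_mono_def image_iff elim!: evenE\<close>)
  moreover have "(\<lambda>n. if odd n then f n else 0) sums b"
    by (rule sums_mono_reindex[THEN iffD1, of "\<lambda>m. 2 * m + 1"])
       (use assms(2) in \<open>auto simp: strict_mono_def image_iff elim!: oddE\<close>)
  ultimately have "(\<lambda>n. (if even n then f n else 0) + (if odd n then f n else 0)) sums (a + b)"
    by (rule sums_add)
  then show ?thesis
    by (rule sums_cong[THEN iffD1, rotated]) simp
qed

subsection \<open>Entire power series and the coefficient functions\<close>

definition powser :: "(nat \<Rightarrow> real) \<Rightarrow> real \<Rightarrow> real" where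
  "powser c z = (\<Sum>m. c m * z ^ m)"

definition entire :: "(nat \<Rightarrow> real) \<Rightarrow> bool" where
  "entire c \<longleftrightarrow> (\<forall>z. summable (\<lambda>m. c m * z ^ m))"

lemma entire_diffs: "entire c \<Longrightarrow> entire (diffs c)"
  unfolding entire_def by (blast intro: termdiff_converges_all)

lemma powser_sums: "entire c \<Longrightarrow> (\<lambda>m. c m * z ^ m) sums powser c z"
  by (simp add: entire_def powser_def summable_sums)

text \<open>The derivative series without index shift, matching the factors m z^(m-1) of the
  reduction.\<close>

lemma powser_diffs_sums:
  assumes "entire c"
  shows "(\<lambda>m. real m * c m * z ^ (m - 1)) sums powser (diffs c) z"
  using diffs_equiv[of c z] entire_diffs[OF assms] by (simp add: entire_def powser_def)

lemma powser_diffs_diffs_sums: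
  assumes "entire c"
  shows "(\<lambda>m. real m * (real m - 1) * c m * z ^ (m - 2)) sums powser (diffs (diffs c)) z"
proof -
  let ?f = "\<lambda>m. real m * (real m - 1) * c m * z ^ (m - 2)"
  \<comment> \<open>\<open>?f 0\<close> vanishes, and the shifted series is the unshifted derivative
    series of \<open>diffs c\<close>.\<close>
  have "(\<lambda>m. ?f (Suc m)) sums powser (diffs (diffs c)) z"
    using powser_diffs_sums[OF entire_diffs[OF assms], of z] by (simp add: diffs_def ac_simps)
  then show ?thesis
    using sums_Suc_iff[of ?f] by simp
qed

lemma DERIV_powser: "entire c \<Longrightarrow> (powser c has_real_derivative powser (diffs c) z) (at z)"
  unfolding entire_def powser_def using termdiffs_strong_converges_everywhere by blast

lemma isCont_powser: "entire c \<Longrightarrow> isCont (powser c) z"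
  using DERIV_powser DERIV_isCont by blast

text \<open>Chain rule for F(-x^2). The closed form may fail at 0, but it holds in a neighbourhood
  of any nonzero \<open>x\<close>.\<close>

lemma powser_diffs_neg_square:
  assumes "entire c" and eq: "\<And>x. x \<noteq> 0 \<Longrightarrow> powser c (- x\<^sup>2) = f x"
    and "(f has_real_derivative D) (at x)" "x \<noteq> 0"
  shows "powser (diffs c) (- x\<^sup>2) = - D / (2 * x)"
proof -
  have "((\<lambda>x. powser c (- x\<^sup>2)) has_real_derivative powser (diffs c) (- x\<^sup>2) * (- (2 * x))) (at x)"
    by (rule DERIV_chain2[OF DERIV_powser[OF assms(1)]]) (auto intro!: derivative_eq_intros)
  moreover have ev: "\<forall>\<^sub>F y in nhds x. powser c (- y\<^sup>2) = f y"
    using t1_space_nhds[OF \<open>x \<noteq> 0\<close>] by eventually_elim (rule eq)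
  ultimately have "(f has_real_derivative powser (diffs c) (- x\<^sup>2) * (- (2 * x))) (at x)"
    by (simp add: DERIV_cong_ev[OF refl ev refl])
  then show ?thesis
    using DERIV_unique[OF assms(3)] \<open>x \<noteq> 0\<close> by (simp add: field_simps)
qed

text \<open>A continuous function agreeing with \<open>f\<close> off 0 supplies the limit at
  0.\<close>

lemma at_zero_by_limit_eq:
  assumes "isCont g 0" "\<And>x. x \<noteq> 0 \<Longrightarrow> f x = g x"
  shows "at_zero_by_limit f x = g x"
proof -
  have "(f \<longlongrightarrow> g 0) (at 0)"
    using assms(1)[unfolded isCont_def]
    by (rule Lim_transform_eventually) (auto simp: eventually_at_filter assms(2))
  then show ?thesis
    using assms(2) by (auto simp: at_zero_by_limit_def intro: tendsto_Lim)
qed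

section \<open>The tails of the cosine and sine series\<close>

definition cos_tail :: "nat \<Rightarrow> real" where
  "cos_tail m = 1 / fact (Suc (Suc (2 * m)))"

text \<open>The weight 1/(i+1)! is \<open>cos_tail m\<close> for odd i = 2m+1 and
  \<open>sin_tail m\<close> for even i = 2m+2.\<close>

definition sin_tail :: "nat \<Rightarrow> real" where
  "sin_tail m = 1 / fact (Suc (Suc (Suc (2 * m))))"

text \<open>Since (2m+k)! is at least m!, the exponential series dominates.\<close>

lemma entire_tail: "entire (\<lambda>m. 1 / fact (2 * m + k))"
  unfolding entire_def
proof
  fix z :: real
  have "norm (1 / fact (2 * m + k) * z ^ m) \<le> inverse (fact m) * \<bar>z\<bar> ^ m" for m
    using fact_mono[of m "2 * m + k", where 'a = real]
    by (auto simp: abs_mult power_abs divide_inverse intro!: mult_right_mono le_imp_inverse_le)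
  then show "summable (\<lambda>m. 1 / fact (2 * m + k) * z ^ m)"
    using summable_exp[of "\<bar>z\<bar>"] by (blast intro: summable_comparison_test')
qed

lemma entire_cos_tail: "entire cos_tail" and entire_sin_tail: "entire sin_tail"
  using entire_tail[of 2] entire_tail[of 3] by (simp_all add: cos_tail_def[abs_def] sin_tail_def[abs_def] numeral_3_eq_3 del: fact_Suc)

lemma power_neg_square: "(- x\<^sup>2) ^ n = (- 1) ^ n * x ^ (2 * n)" for x :: real
  by (simp add: power_minus[of "x\<^sup>2"] power_mult)

lemma powser_cos_tail:
  assumes "x \<noteq> 0" shows "powser cos_tail (- x\<^sup>2) = (1 - cos x) / x\<^sup>2"
proof -
  let ?f = "\<lambda>n. (- 1) ^ n / (fact (2 * n)) * x ^ (2 * n)"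
  have "(\<lambda>n. ?f (Suc n)) sums (cos x - 1)"
    using sums_Suc_iff[of ?f "cos x - 1"] cos_paired[of x] by simp
  \<comment> \<open>Without its constant term the cosine series is divisible by -x^2.\<close>
  from sums_mult[OF this, of "- 1 / x\<^sup>2"] have "(\<lambda>n. cos_tail n * (- x\<^sup>2) ^ n) sums (- 1 / x\<^sup>2 * (cos x - 1))"
    unfolding power_neg_square cos_tail_def
    using assms by (simp add: power2_eq_square field_simps del: fact_Suc)
  then show ?thesis
    using sums_unique2 powser_sums[OF entire_cos_tail] assms by (fastforce simp: field_simps)
qed

lemma powser_sin_tail:
  assumes "x \<noteq> 0" shows "powser sin_tail (- x\<^sup>2) = (x - sin x) / x ^ 3"
proof -
  let ?f = "\<lambda>n. (- 1) ^ n / (fact (2 * n + 1)) * x ^ (2 * n + 1)"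
  have "(\<lambda>n. ?f (Suc n)) sums (sin x - x)"
    using sums_Suc_iff[of ?f "sin x - x"] sin_paired[of x] by simp
  from sums_mult[OF this, of "- 1 / x ^ 3"] have "(\<lambda>n. sin_tail n * (- x\<^sup>2) ^ n) sums (- 1 / x ^ 3 * (sin x - x))"
    unfolding power_neg_square sin_tail_def
    using assms by (simp add: power3_eq_cube field_simps numeral_3_eq_3 del: fact_Suc)
  then show ?thesis
    using sums_unique2 powser_sums[OF entire_sin_tail] assms by (fastforce simp: field_simps)
qed

lemma powser_diffs_cos_tail:
  assumes "x \<noteq> 0" shows "powser (diffs cos_tail) (- x\<^sup>2) = (2 - 2 * cos x - x * sin x) / (2 * x ^ 4)"
proof -
  have "((\<lambda>x. (1 - cos x) / x\<^sup>2) has_real_derivative (x * sin x - 2 + 2 * cos x) / x ^ 3) (at x)"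
    using assms by (auto intro!: derivative_eq_intros simp: field_simps power_numeral_reduce)
  from powser_diffs_neg_square[OF entire_cos_tail powser_cos_tail this assms] show ?thesis
    using assms by (simp add: field_simps power_numeral_reduce)
qed

lemma powser_diffs_diffs_cos_tail:
  assumes "x \<noteq> 0"
  shows "powser (diffs (diffs cos_tail)) (- x\<^sup>2) = (8 - 5 * x * sin x + x\<^sup>2 * cos x - 8 * cos x) / (4 * x ^ 6)"
proof -
  have "((\<lambda>x. (2 - 2 * cos x - x * sin x) / (2 * x ^ 4)) has_real_derivative
      - (8 - 5 * x * sin x + x\<^sup>2 * cos x - 8 * cos x) / (2 * x ^ 5)) (at x)"
    using assms by (auto intro!: derivative_eq_intros simp: field_simps power_numeral_reduce)
  from powser_diffs_neg_square[OF entire_diffs[OF entire_cos_tail] powser_diffs_cos_tail this assms] show ?thesis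
    using assms by (simp add: field_simps power_numeral_reduce)
qed

lemma powser_diffs_sin_tail:
  assumes "x \<noteq> 0" shows "powser (diffs sin_tail) (- x\<^sup>2) = (2 * x - 3 * sin x + x * cos x) / (2 * x ^ 5)"
proof -
  have "((\<lambda>x. (x - sin x) / x ^ 3) has_real_derivative - (2 * x - 3 * sin x + x * cos x) / x ^ 4) (at x)"
    using assms by (auto intro!: derivative_eq_intros simp: field_simps power_numeral_reduce)
  from powser_diffs_neg_square[OF entire_sin_tail powser_sin_tail this assms] show ?thesis
    using assms by (simp add: field_simps power_numeral_reduce)
qed

lemma powser_diffs_diffs_sin_tail:
  assumes "x \<noteq> 0"
  shows "powser (diffs (diffs sin_tail)) (- x\<^sup>2) =
     - (15 * sin x - x\<^sup>2 * sin x - 7 * x * cos x - 8 * x) / (4 * x ^ 7)"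
proof -
  have "((\<lambda>x. (2 * x - 3 * sin x + x * cos x) / (2 * x ^ 5)) has_real_derivative
      (15 * sin x - x\<^sup>2 * sin x - 7 * x * cos x - 8 * x) / (2 * x ^ 6)) (at x)"
    using assms by (auto intro!: derivative_eq_intros simp: field_simps power_numeral_reduce)
  from powser_diffs_neg_square[OF entire_diffs[OF entire_sin_tail] powser_diffs_sin_tail this assms] show ?thesis
    using assms by (simp add: field_simps power_numeral_reduce)
qed

lemma isCont_powser_neg_square: "entire c \<Longrightarrow> isCont (\<lambda>x. powser c (- x\<^sup>2)) x"
  by (rule isCont_o2[OF _ isCont_powser]) auto

lemmas tail_isCont =
  isCont_powser_neg_square[OF entire_cos_tail]
  isCont_powser_neg_square[OF entire_diffs[OF entire_cos_tail]]
  isCont_powser_neg_square[OF entire_diffs[OF entire_diffs[OF entire_cos_tail]]]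
  isCont_powser_neg_square[OF entire_sin_tail]
  isCont_powser_neg_square[OF entire_diffs[OF entire_sin_tail]]
  isCont_powser_neg_square[OF entire_diffs[OF entire_diffs[OF entire_sin_tail]]]

lemmas tail_closed_forms =
  powser_cos_tail powser_diffs_cos_tail powser_diffs_diffs_cos_tail
  powser_sin_tail powser_diffs_sin_tail powser_diffs_diffs_sin_tail

lemma beta_powser:
  "beta1 x = - powser cos_tail (- x\<^sup>2) - x\<^sup>2 * powser (diffs cos_tail) (- x\<^sup>2)"
  "beta2 x = powser sin_tail (- x\<^sup>2) + x\<^sup>2 * powser (diffs sin_tail) (- x\<^sup>2)"
  "beta3 x = - powser (diffs cos_tail) (- x\<^sup>2)"
  "beta4 x = powser (diffs sin_tail) (- x\<^sup>2)"
  unfolding beta1_def beta2_def beta3_def beta4_def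
  by (rule at_zero_by_limit_eq,
      intro continuous_intros tail_isCont,
      (simp add: tail_closed_forms; simp add: field_simps power_numeral_reduce))+

text \<open>In the z-derivative of E - z E' the first derivatives cancel, so only second ones
  remain. The factor \<open>x\<close> from the chain rule later absorbs the division in
  \<open>theta_rate\<close>.\<close>

lemma dbeta_powser:
  "dbeta1 x = 2 * x ^ 3 * powser (diffs (diffs cos_tail)) (- x\<^sup>2)"
  "dbeta2 x = - 2 * x ^ 3 * powser (diffs (diffs sin_tail)) (- x\<^sup>2)"
  "dbeta3 x = 2 * x * powser (diffs (diffs cos_tail)) (- x\<^sup>2)"
  "dbeta4 x = - 2 * x * powser (diffs (diffs sin_tail)) (- x\<^sup>2)"
  unfolding dbeta1_def dbeta2_def dbeta3_def dbeta4_def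
  by (rule at_zero_by_limit_eq,
      intro continuous_intros tail_isCont,
      (simp add: tail_closed_forms; simp add: field_simps power_numeral_reduce))+

subsection \<open>Summation of the reduced series\<close>

lemma sums_scaleR_const: "f sums a \<Longrightarrow> (\<lambda>n. f n *\<^sub>R v) sums (a *\<^sub>R v)"
  for v :: "'a::real_normed_vector"
  by (rule bounded_linear.sums[OF bounded_linear_scaleR_left])

lemma powser_minus_sums:
  assumes "entire c"
  shows "(\<lambda>m. c m * ((1 - real m) * z ^ m)) sums (powser c z - z * powser (diffs c) z)"
proof -
  have "c m * z ^ m - z * (real m * c m * z ^ (m - 1)) = c m * ((1 - real m) * z ^ m)" for m
    by (cases m) (simp_all add: algebra_simps)
  then show ?thesis
    using sums_diff[OF powser_sums[OF assms, of z] sums_mult[OF powser_diffs_sums[OF assms, of z], of z]]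
    by simp
qed

lemma powser_minus_deriv_sums:
  assumes "entire c"
  shows "(\<lambda>m. c m * (real m * (1 - real m) * z ^ (m - 1) * z')) sums (- z * z' * powser (diffs (diffs c)) z)"
proof -
  have "- z * z' * (real m * (real m - 1) * c m * z ^ (m - 2)) = c m * (real m * (1 - real m) * z ^ (m - 1) * z')" for m
  \<comment> \<open>Below 2 the truncated exponents need not match, but m (m - 1) is zero.\<close>
  proof (cases "m < 2")
    case True
    then have "m = 0 \<or> m = 1" by auto
    then show ?thesis by auto
  next
    case False
    then obtain n where "m = n + 2" by (metis add.commute le_Suc_ex not_less)
    then show ?thesis by (simp add: algebra_simps)
  qed
  then show ?thesis
    using sums_mult[OF powser_diffs_diffs_sums[OF assms, of z], of "- z * z'"] by simp
qed

text \<open>One parity class of powers: \<open>k = 0\<close> collects the odd ones,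
  \<open>k = 1\<close> the even ones from 2 on.\<close>

lemma mpow_series:
  assumes "entire c" and A5: "mpow A 5 = (2 * z) *\<^sub>R mpow A 3 + (- (z\<^sup>2)) *\<^sub>R mpow A 1"
  shows "(\<lambda>m. c m *\<^sub>R mpow A (2 * m + Suc k)) sums
    ((powser c z - z * powser (diffs c) z) *\<^sub>R mpow A (Suc k) + powser (diffs c) z *\<^sub>R mpow A (k + 3))"
  unfolding mpow_reduce[OF A5]
  using sums_add[OF sums_scaleR_const[OF powser_minus_sums[OF assms(1), of z], of "mpow A (Suc k)"]
      sums_scaleR_const[OF powser_diffs_sums[OF assms(1), of z], of "mpow A (k + 3)"]]
  by (simp add: scaleR_right_distrib ac_simps)

lemma mpow_deriv_series:
  assumes "entire c"
    and A5: "\<And>t. mpow (A + t *\<^sub>R H) 5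
      = (2 * z t) *\<^sub>R mpow (A + t *\<^sub>R H) 3 + (- ((z t)\<^sup>2)) *\<^sub>R mpow (A + t *\<^sub>R H) 1"
    and z: "(z has_real_derivative z') (at 0)"
  shows "(\<lambda>m. c m *\<^sub>R mpow_deriv A H y (2 * m + Suc k)) sums
    ((- z 0 * z' * powser (diffs (diffs c)) (z 0)) *\<^sub>R (mpow A (Suc k) *v y)
     + (powser c (z 0) - z 0 * powser (diffs c) (z 0)) *\<^sub>R mpow_deriv A H y (Suc k)
     + (z' * powser (diffs (diffs c)) (z 0)) *\<^sub>R (mpow A (k + 3) *v y)
     + powser (diffs c) (z 0) *\<^sub>R mpow_deriv A H y (k + 3))"
  unfolding mpow_deriv_reduce[OF A5 z]
  using sums_add[OF sums_add[OF sums_add[OF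
      sums_scaleR_const[OF powser_minus_deriv_sums[OF assms(1), of "z 0" z'], of "mpow A (Suc k) *v y"]
      sums_scaleR_const[OF powser_minus_sums[OF assms(1), of "z 0"], of "mpow_deriv A H y (Suc k)"]]
      sums_scaleR_const[OF sums_mult[OF powser_diffs_diffs_sums[OF assms(1), of "z 0"], of z'], of "mpow A (k + 3) *v y"]]
      sums_scaleR_const[OF powser_diffs_sums[OF assms(1), of "z 0"], of "mpow_deriv A H y (k + 3)"]]
  by (simp add: scaleR_right_distrib ac_simps)

text \<open>The term i = 0 stands apart; odd i carry the minus sign. \<open>F\<close> is
  \<open>mpow\<close> for the Jacobian and \<open>mpow_deriv\<close> for the correction.\<close>

lemma jacobian_series_split:
  fixes F :: "nat \<Rightarrow> 'a::real_normed_vector"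
  assumes "(\<lambda>m. cos_tail m *\<^sub>R F (Suc (2 * m))) sums a" "(\<lambda>m. sin_tail m *\<^sub>R F (Suc (Suc (2 * m)))) sums b"
  shows "(\<lambda>i. ((- 1) ^ i / fact (i + 1)) *\<^sub>R F i) sums (F 0 - a + b)"
proof -
  let ?f = "\<lambda>i. ((- 1) ^ i / fact (i + 1)) *\<^sub>R F i"
  have "(\<lambda>n. ?f (Suc n)) sums (- a + b)"
    by (rule sums_even_odd)
       (use sums_minus[OF assms(1)] assms(2) in \<open>simp_all add: cos_tail_def sin_tail_def del: fact_Suc\<close>)
  then show ?thesis
    using sums_Suc_iff[of ?f "- a + b"] by (simp add: algebra_simps)
qed

lemma sum_1_4: "(\<Sum>j=1..4. f j) = f 1 + f 2 + f 3 + f (4::nat)" for f :: "nat \<Rightarrow> 'a::comm_monoid_add"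
  by (simp add: eval_nat_numeral add.assoc)

section \<open>The relation for \<open>adm\<close> and the two formulas\<close>

lemma adm_power5:
  "mpow (adm x) 5 = (2 * - (rot_part x \<bullet> rot_part x)) *\<^sub>R mpow (adm x) 3
    + (- ((- (rot_part x \<bullet> rot_part x))\<^sup>2)) *\<^sub>R mpow (adm x) 1"
  unfolding matrix_eq
  using adm_power5_vec[of x]
  by (simp only: matrix_vector_mult_add_rdistrib scaleR_matrix_vector_assoc[symmetric])
     (simp add: eval_nat_numeral mpow_Suc matrix_vector_mul_assoc[symmetric] adm_mult_vec)

lemma dexpm_uminus:
  fixes \<xi> :: "real^9"
  defines "\<theta> \<equiv> norm (rot_part \<xi>)"
  shows "dexpm (- \<xi>) = mat 1 + (\<Sum>j=1..4. beta j \<theta> *\<^sub>R mpow (adm \<xi>) j)"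
proof -
  let ?A = "adm \<xi>"
  have A5: "mpow ?A 5 = (2 * - \<theta>\<^sup>2) *\<^sub>R mpow ?A 3 + (- ((- \<theta>\<^sup>2)\<^sup>2)) *\<^sub>R mpow ?A 1"
    using adm_power5[of \<xi>] by (simp only: \<theta>_def power2_norm_eq_inner)
  have "mpow (- ?A) i = (- 1) ^ i *\<^sub>R mpow ?A i" for i
    using mpow_scaleR[of "- 1" ?A i] by simp
  then have "dexpm (- \<xi>) = (\<Sum>i. ((- 1) ^ i / fact (i + 1)) *\<^sub>R mpow ?A i)"
    by (simp add: dexpm_def adm_uminus)
  also have "\<dots> = mat 1 + (\<Sum>j=1..4. beta j \<theta> *\<^sub>R mpow ?A j)"
    using jacobian_series_split[of "mpow ?A",
        OF mpow_series[OF entire_cos_tail A5, of 0, simplified]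
          mpow_series[OF entire_sin_tail A5, of 1, simplified], THEN sums_unique]
    by (simp add: sum_1_4 beta_def beta_powser algebra_simps numeral_eq_Suc)
  finally show ?thesis .
qed

lemma ito_correction_eq:
  fixes \<xi> \<gamma> :: "real^9"
  defines "\<theta> \<equiv> norm (rot_part \<xi>)"
  shows "ito_correction \<xi> \<gamma> =
    (\<Sum>j=1..4. (dbeta j \<theta> * theta_rate \<xi> \<gamma>) *\<^sub>R (mpow (adm \<xi>) j *v \<gamma>) + beta j \<theta> *\<^sub>R adm_sum \<xi> \<gamma> j)"
proof -
  let ?A = "adm \<xi>" and ?H = "adm \<gamma>" and ?w = "rot_part \<xi>" and ?h = "rot_part \<gamma>"
  \<comment> \<open>Minus the squared rotation norm along the line, so that the degree five relation
    holds for every \<open>t\<close>.\<close>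
  define z where "z t = - (rot_part (\<xi> + t *\<^sub>R \<gamma>) \<bullet> rot_part (\<xi> + t *\<^sub>R \<gamma>))" for t
  have A5: "mpow (?A + t *\<^sub>R ?H) 5
      = (2 * z t) *\<^sub>R mpow (?A + t *\<^sub>R ?H) 3 + (- ((z t)\<^sup>2)) *\<^sub>R mpow (?A + t *\<^sub>R ?H) 1" for t
    using adm_power5[of "\<xi> + t *\<^sub>R \<gamma>"] unfolding adm_add_scaleR z_def .
  have "z = (\<lambda>t. - (?w \<bullet> ?w + t * (2 * (?w \<bullet> ?h)) + t\<^sup>2 * (?h \<bullet> ?h)))"
    by (simp add: fun_eq_iff z_def inner_add_left inner_add_right inner_commute[of ?h ?w] power2_eq_square algebra_simps)
  then have z': "(z has_real_derivative - 2 * (?w \<bullet> ?h)) (at 0)"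
    by (auto intro!: derivative_eq_intros)
  have z0: "z 0 = - \<theta>\<^sup>2"
    by (simp add: z_def \<theta>_def power2_norm_eq_inner)
  \<comment> \<open>This holds at \<theta> = 0 too, where the rotation part and hence both sides
    vanish.\<close>
  have rate: "?w \<bullet> ?h = \<theta> * theta_rate \<xi> \<gamma>"
    by (simp add: theta_rate_def \<theta>_def)
  have adm_sum: "adm_sum \<xi> \<gamma> = mpow_deriv ?A ?H \<gamma>"
    by (simp add: fun_eq_iff adm_sum_def mpow_deriv_def)
  have D0: "mpow_deriv ?A ?H \<gamma> 0 = 0"
    by (simp add: mpow_deriv_def)
  let ?C = "\<lambda>c. powser c (z 0)"
  have \<beta>: "beta 1 \<theta> = - (?C cos_tail - z 0 * ?C (diffs cos_tail))"
    "beta 2 \<theta> = ?C sin_tail - z 0 * ?C (diffs sin_tail)"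
    "beta 3 \<theta> = - ?C (diffs cos_tail)" "beta 4 \<theta> = ?C (diffs sin_tail)"
    by (simp_all add: beta_def beta_powser z0)
  have d\<beta>:
    "dbeta 1 \<theta> * theta_rate \<xi> \<gamma> = - (- z 0 * (- 2 * (?w \<bullet> ?h)) * ?C (diffs (diffs cos_tail)))"
    "dbeta 2 \<theta> * theta_rate \<xi> \<gamma> = - z 0 * (- 2 * (?w \<bullet> ?h)) * ?C (diffs (diffs sin_tail))"
    "dbeta 3 \<theta> * theta_rate \<xi> \<gamma> = - (- 2 * (?w \<bullet> ?h) * ?C (diffs (diffs cos_tail)))"
    "dbeta 4 \<theta> * theta_rate \<xi> \<gamma> = - 2 * (?w \<bullet> ?h) * ?C (diffs (diffs sin_tail))"
    by (simp_all add: dbeta_def dbeta_powser z0 rate power2_eq_square power3_eq_cube)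
  note cos_series = mpow_deriv_series[OF entire_cos_tail A5 z', of \<gamma> 0, unfolded add_Suc_right add_0_right]
  note sin_series = mpow_deriv_series[OF entire_sin_tail A5 z', of \<gamma> 1, unfolded add_Suc_right One_nat_def add_0_right]
  have exps: "Suc 0 = 1" "0 + 3 = (3::nat)" "1 + 3 = (4::nat)" "Suc 0 + 3 = (4::nat)"
    by simp_all
  show ?thesis
    unfolding ito_correction_def adm_sum
      sums_unique[OF jacobian_series_split[of "mpow_deriv ?A ?H \<gamma>", OF cos_series sin_series], symmetric]
    unfolding D0 exps sum_1_4 \<beta> d\<beta> scaleR_minus_left by (simp add: numeral_2_eq_2)
qed

theorem proposition3:
  fixes X Xh :: "real^5^5" and U :: "(real^9) set" and c :: invariance
    and s \<gamma> :: "9 \<Rightarrow> real^9" and \<xi> :: "real^9" and \<theta> :: real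
  assumes "X \<in> SE23" and "Xh \<in> SE23"
    and "log_chart U"
    and "group_error c Xh X \<in> (\<lambda>x. mexp (hat x)) ` U"
    and "\<xi> = logm U (group_error c Xh X)"
    and "invertible (dexpm (- \<xi>))"
    and "\<And>k. \<gamma> k = diffusion_coeff c Xh \<xi> (s k)"
    and "\<theta> = norm (rot_part \<xi>)"
  shows "dexpm (- \<xi>) = mat 1 + (\<Sum>j=1..4. beta j \<theta> *\<^sub>R mpow (adm \<xi>) j)
    \<and> (\<forall>k. ito_correction \<xi> (\<gamma> k) =
         (\<Sum>j=1..4. (dbeta j \<theta> * theta_rate \<xi> (\<gamma> k)) *\<^sub>R (mpow (adm \<xi>) j *v \<gamma> k)
                   + beta j \<theta> *\<^sub>R adm_sum \<xi> (\<gamma> k) j))"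
  unfolding \<open>\<theta> = norm (rot_part \<xi>)\<close> using dexpm_uminus ito_correction_eq by blast

end
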